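(* Consider the portfolio algorithm NOPA (described in the context) run with $M\ge 2$ solvers, a lag function $\mathrm{lag}$, and two non-decreasing integer sequences $(r_n)_{n\in\mathbb N^*}$ and $(s_n)_{n\in\mathbb N^*}$ (comparison times and numbers of resamplings). Assume that: (a) $\mathrm{Var}\, f(x)\le 1$ for all $x\in\mathcal D$; (b) for some positive sequence $(\epsilon_n)_{n\in\mathbb N^*}$, the property $P_{as}((\epsilon_n)_{n\in\mathbb N^*})$ (defined in the context) is true. Then there exists $n_0$ such that for all $n\ge n_0$, $$SR^{Selection}_{r_n} < SR^{Solvers}_{r_n} + 2\epsilon_{r_n}$$ with probability at least $1-\frac{M}{s_n\,\epsilon_{\mathrm{lag}(r_n)}^2}$, after $e_n = r_n\cdot M\cdot\left(1+\sum_{i=1}^n \frac{s_i}{r_n}\right)$ evaluations. Moreover, if $(s_n)$, $\mathrm{lag}$, $(r_n)$ and $(\epsilon_n)$ satisfy $\sum_{j=1}^{\infty}\frac{1}{s_j\,\epsilon_{\mathrm{lag}(r_j)}^2}<\infty$, then, almost surely, there exists $n_0$ such that for all $n\ge n_0$, $$SR^{Selection}_{r_n} < SR^{Solvers}_{r_n} + 2\epsilon_{r_n}$$ after $e_n = r_n\cdot M\cdot\left(1+\sum_{i=1}^n \frac{s_i}{r_n}\right)$ evaluations.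
   Context: $\mathbb N^*=\{1,2,3,\dots\}$. The objective is a noisy function $f$ on a domain $\mathcal D\subset\mathbb R^d$: each call at $x$ returns $f(x)=f(x,\omega)\in\mathbb R$ where $\omega$ is a random variable sampled independently at each call. The goal is to minimize $x\mapsto \mathbb E_\omega f(x,\omega)$, whose minimizer is $x^*$. For $s\in\mathbb N^*$, $\hat{\mathbb E}_s[f(x)]=\frac1s\sum_{j=1}^s f(x)^{(j)}$ is the average of $s$ independent evaluations of $f$ at $x$ (using fresh noise). There are $M\ge2$ solvers. $\tilde x_{i,n}\in\mathcal D$ is the (random) point recommended by solver $i\in\{1,\dots,M\}$ after it has spent $n$ function evaluations. Its simple regret is $SR_{i,n}=\mathbb E_\omega\left(f(\tilde x_{i,n},\omega)-f(x^*,\omega)\right)$, where the expectation is only over the fresh noise $\omega$, so that $SR_{i,n}$ is a random variable depending on $\tilde x_{i,n}$. Put $SR^{Solvers}_n=\min_{1\le i\le M}SR_{i,n}$ and $\Delta_{i,n}=SR_{i,n}-\min_{1\le j\le M}SR_{j,n}$. A lag function is a non-decreasing function $\mathrm{lag}:\mathbb N^*\to\mathbb N^*$ with $\mathrm{lag}(n)\le n$ for all $n$. NOPA (Noisy Optimization Portfolio Algorithm): at each iteration every solver receives one evaluation, so at iteration $r_n$ each solver has spent $r_n$ evaluations. At iteration $r_n$ the $n$-th selection is made: $s_n$ fresh evaluations are spent at each of the points $\tilde x_{i,\mathrm{lag}(r_n)}$, $i=1,\dots,M$, and the selected solver is $i^*=i^*_{r_n}\in\arg\min_{i\in\{1,\dots,M\}}\hat{\mathbb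 E}_{s_n}[f(\tilde x_{i,\mathrm{lag}(r_n)})]$. For all iterations $m\in\{r_n,\dots,r_{n+1}-1\}$ the portfolio recommends $\tilde x_{i^*,m}$. The evaluations counted are those spent in running the $M$ solvers together with the $s_k$ comparison evaluations per solver at each selection $k$. The selection regret is $SR^{Selection}_{r_n}=\mathbb E_\omega\left(f(\tilde x_{i^*_{r_n},r_n},\omega)-f(x^*,\omega)\right)=SR_{i^*_{r_n},r_n}$. "After $e_n$ evaluations" means that the recommendation made at iteration $r_n$ is available after $e_n$ function evaluations in total. Property $P_{as}((\epsilon_n)_{n\in\mathbb N^*})$: for every $i\in\{1,\dots,M\}$, almost surely, there exists $n_0$ such that for all $n_1\ge n_0$: $\Delta_{i,n_1}<2\epsilon_{n_1}$ implies that $\Delta_{i,n_2}<2\epsilon_{n_2}$ for all $n_2\ge n_1$.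
   Formalization: The formal version adds lag(r_n) → ∞ (the claim fails for a constant lag) and reads the first part as: almost surely there is a (random) n_0 such that for n ≥ n_0 the bound holds for the probability conditional on the solvers' trajectories; a deterministic n_0 with unconditional probability fails. *)

theory Defs
  imports "HOL-Probability.Probability"
begin

text \<open>
  Sequences indexed by the positive integers are functions on \<^typ>\<open>nat\<close> whose value at 0 is
  never used.

  \<open>P\<close> is the underlying probability space, \<open>N\<close> the law of the noise of one evaluation, \<open>f x w\<close> the
  value returned by an evaluation at \<open>x\<close> with noise \<open>w\<close>, and \<open>X i n\<close> the point recommended by
  solver \<open>i\<close> after \<open>n\<close> of its own evaluations.
\<close>

definition point_regret ::
  "'w measure \<Rightarrow> ('x \<Rightarrow> 'w \<Rightarrow> real) \<Rightarrow> 'x \<Rightarrow> 'x \<Rightarrow> real"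
where
  "point_regret N f xstar x = (\<integral>w. (f x w - f xstar w) \<partial>N)"

definition SR ::
  "'w measure \<Rightarrow> ('x \<Rightarrow> 'w \<Rightarrow> real) \<Rightarrow> 'x \<Rightarrow> (nat \<Rightarrow> nat \<Rightarrow> 'o \<Rightarrow> 'x) \<Rightarrow> nat \<Rightarrow> nat \<Rightarrow> 'o \<Rightarrow> real"
where
  "SR N f xstar X i n \<omega> = point_regret N f xstar (X i n \<omega>)"

definition SR_solvers ::
  "'w measure \<Rightarrow> ('x \<Rightarrow> 'w \<Rightarrow> real) \<Rightarrow> 'x \<Rightarrow> nat \<Rightarrow> (nat \<Rightarrow> nat \<Rightarrow> 'o \<Rightarrow> 'x) \<Rightarrow> nat \<Rightarrow> 'o \<Rightarrow> real"
where
  "SR_solvers N f xstar M X n \<omega> = Min ((\<lambda>i. SR N f xstar X i n \<omega>) ` {1..M})"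

definition regret_gap ::
  "'w measure \<Rightarrow> ('x \<Rightarrow> 'w \<Rightarrow> real) \<Rightarrow> 'x \<Rightarrow> nat \<Rightarrow> (nat \<Rightarrow> nat \<Rightarrow> 'o \<Rightarrow> 'x) \<Rightarrow> nat \<Rightarrow> nat \<Rightarrow> 'o \<Rightarrow> real"
where
  "regret_gap N f xstar M X i n \<omega> = SR N f xstar X i n \<omega> - SR_solvers N f xstar M X n \<omega>"

definition P_as ::
  "'o measure \<Rightarrow> 'w measure \<Rightarrow> ('x \<Rightarrow> 'w \<Rightarrow> real) \<Rightarrow> 'x \<Rightarrow> nat \<Rightarrow> (nat \<Rightarrow> nat \<Rightarrow> 'o \<Rightarrow> 'x)
    \<Rightarrow> (nat \<Rightarrow> real) \<Rightarrow> bool"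
where
  "P_as P N f xstar M X \<epsilon> \<longleftrightarrow>
     (\<forall>i\<in>{1..M}. AE \<omega> in P. \<exists>n0\<ge>1. \<forall>n1\<ge>n0.
        regret_gap N f xstar M X i n1 \<omega> < 2 * \<epsilon> n1 \<longrightarrow>
        (\<forall>n2\<ge>n1. regret_gap N f xstar M X i n2 \<omega> < 2 * \<epsilon> n2))"

text \<open>
  \<open>W (n, i, j)\<close> is the noise of the \<open>j\<close>-th comparison evaluation at the point of solver \<open>i\<close> made for
  the \<open>n\<close>-th selection.
\<close>

definition empirical_mean ::
  "('x \<Rightarrow> 'w \<Rightarrow> real) \<Rightarrow> (nat \<Rightarrow> nat \<Rightarrow> 'o \<Rightarrow> 'x) \<Rightarrow> (nat \<times> nat \<times> nat \<Rightarrow> 'o \<Rightarrow> 'w)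
    \<Rightarrow> (nat \<Rightarrow> nat) \<Rightarrow> (nat \<Rightarrow> nat) \<Rightarrow> (nat \<Rightarrow> nat) \<Rightarrow> nat \<Rightarrow> nat \<Rightarrow> 'o \<Rightarrow> real"
where
  "empirical_mean f X W lag r s n i \<omega> =
     (1 / real (s n)) * (\<Sum>j=1..s n. f (X i (lag (r n)) \<omega>) (W (n, i, j) \<omega>))"

text \<open>
  \<open>isel n\<close> is the solver chosen by the \<open>n\<close>-th selection, so that \<open>X (isel n \<omega>) (r n) \<omega>\<close> is the
  recommendation of the portfolio at iteration \<open>r n\<close>.
\<close>

definition SR_selection ::
  "'w measure \<Rightarrow> ('x \<Rightarrow> 'w \<Rightarrow> real) \<Rightarrow> 'x \<Rightarrow> (nat \<Rightarrow> nat \<Rightarrow> 'o \<Rightarrow> 'x)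
    \<Rightarrow> (nat \<Rightarrow> nat) \<Rightarrow> (nat \<Rightarrow> 'o \<Rightarrow> nat) \<Rightarrow> nat \<Rightarrow> 'o \<Rightarrow> real"
where
  "SR_selection N f xstar X r isel n \<omega> = point_regret N f xstar (X (isel n \<omega>) (r n) \<omega>)"

definition lag_function :: "(nat \<Rightarrow> nat) \<Rightarrow> bool"
where
  "lag_function lag \<longleftrightarrow> mono_on {1..} lag \<and> (\<forall>n\<ge>1. 1 \<le> lag n \<and> lag n \<le> n)"

abbreviation trajectory_space :: "'x::topological_space set \<Rightarrow> nat \<Rightarrow> (nat \<times> nat \<Rightarrow> 'x) measure"
where
  "trajectory_space D M \<equiv> PiM ({1..M} \<times> {1..}) (\<lambda>_. restrict_space borel D)"

definition trajectory :: "nat \<Rightarrow> (nat \<Rightarrow> nat \<Rightarrow> 'o \<Rightarrow> 'x) \<Rightarrow> 'o \<Rightarrow> (nat \<times> nat \<Rightarrow> 'x)"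
where
  "trajectory M X \<omega> = (\<lambda>(i, n)\<in>{1..M} \<times> {1..}. X i n \<omega>)"

definition solver_algebra ::
  "'o measure \<Rightarrow> 'x::topological_space set \<Rightarrow> nat \<Rightarrow> (nat \<Rightarrow> nat \<Rightarrow> 'o \<Rightarrow> 'x) \<Rightarrow> 'o measure"
where
  "solver_algebra P D M X =
     vimage_algebra (space P) (trajectory M X) (trajectory_space D M)"

text \<open>
  Conditional probability of the event \<open>A\<close> given the trajectories of all solvers, i.e. the
  probability over the comparison noise (and the tie-breaking).
\<close>

definition prob_given_solvers ::
  "'o measure \<Rightarrow> 'x::topological_space set \<Rightarrow> nat \<Rightarrow> (nat \<Rightarrow> nat \<Rightarrow> 'o \<Rightarrow> 'x) \<Rightarrow> 'o set \<Rightarrow> 'o \<Rightarrow> real"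
where
  "prob_given_solvers P D M X A = real_cond_exp P (solver_algebra P D M X) (indicator A)"

definition comparison_index :: "nat \<Rightarrow> (nat \<Rightarrow> nat) \<Rightarrow> (nat \<times> nat \<times> nat) set"
where
  "comparison_index M s = {(n, i, j). 1 \<le> n \<and> 1 \<le> i \<and> i \<le> M \<and> 1 \<le> j \<and> j \<le> s n}"

definition comparison_algebra ::
  "'o measure \<Rightarrow> 'w measure \<Rightarrow> nat \<Rightarrow> (nat \<Rightarrow> nat) \<Rightarrow> (nat \<times> nat \<times> nat \<Rightarrow> 'o \<Rightarrow> 'w) \<Rightarrow> 'o measure"
where
  "comparison_algebra P N M s W =
     vimage_algebra (space P) (\<lambda>\<omega>. \<lambda>k\<in>comparison_index M s. W k \<omega>)
       (PiM (comparison_index M s) (\<lambda>_. N))"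

text \<open>
  The function evaluations made by the time the recommendation of the \<open>n\<close>-th selection is available:
  \<open>Solver_Eval i m\<close> is the evaluation given to solver \<open>i\<close> at iteration \<open>m\<close>, and
  \<open>Comparison_Eval k i j\<close> is the one with noise \<open>W (k, i, j)\<close>.
\<close>

datatype evaluation = Solver_Eval nat nat | Comparison_Eval nat nat nat

definition nopa_evaluations ::
  "nat \<Rightarrow> (nat \<Rightarrow> nat) \<Rightarrow> (nat \<Rightarrow> nat) \<Rightarrow> nat \<Rightarrow> evaluation set"
where
  "nopa_evaluations M r s n =
     {Solver_Eval i m | i m. i \<in> {1..M} \<and> m \<in> {1..r n}} \<union>
     {Comparison_Eval k i j | k i j. k \<in> {1..n} \<and> (k, i, j) \<in> comparison_index M s}"

text \<open>
  A run of the portfolio. The last three conditions say that the comparison evaluations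
  use fresh noise: they are i.i.d. with law \<open>N\<close>, and jointly independent of the solvers'
  trajectories (the solvers run on their own evaluations only). Ties in the arg min may be broken
  in any measurable way. Integrability of \<open>f x\<close> is what makes its expectation meaningful.
\<close>

locale nopa = P: prob_space P + N: prob_space N
  for P :: "'o measure" and N :: "'w measure"
    and D :: "(real ^ 'd) set" and f :: "real ^ 'd \<Rightarrow> 'w \<Rightarrow> real" and xstar :: "real ^ 'd"
    and M :: nat and X :: "nat \<Rightarrow> nat \<Rightarrow> 'o \<Rightarrow> real ^ 'd"
    and W :: "nat \<times> nat \<times> nat \<Rightarrow> 'o \<Rightarrow> 'w"
    and lag r s :: "nat \<Rightarrow> nat" and isel :: "nat \<Rightarrow> 'o \<Rightarrow> nat" +
  assumes f_measurable:
      "(\<lambda>(x, w). f x w) \<in> borel_measurable (restrict_space borel D \<Otimes>\<^sub>M N)"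
    and f_integrable: "\<And>x. x \<in> D \<Longrightarrow> integrable N (f x)"
    and xstar_in: "xstar \<in> D"
    and xstar_minimizer: "\<And>x. x \<in> D \<Longrightarrow> (\<integral>w. f xstar w \<partial>N) \<le> (\<integral>w. f x w \<partial>N)"
    and M_ge_2: "2 \<le> M"
    and X_measurable:
      "\<And>i n. i \<in> {1..M} \<Longrightarrow> 1 \<le> n \<Longrightarrow> X i n \<in> P \<rightarrow>\<^sub>M restrict_space borel D"
    and lag_function: "lag_function lag"
    and r_mono: "mono_on {1..} r" and r_pos: "\<And>n. 1 \<le> n \<Longrightarrow> 1 \<le> r n"
    and s_mono: "mono_on {1..} s" and s_pos: "\<And>n. 1 \<le> n \<Longrightarrow> 1 \<le> s n"
    and isel_measurable: "\<And>n. 1 \<le> n \<Longrightarrow> isel n \<in> P \<rightarrow>\<^sub>M count_space UNIV"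
    and isel_arg_min: "\<And>n \<omega>. 1 \<le> n \<Longrightarrow> \<omega> \<in> space P \<Longrightarrow>
      is_arg_min (\<lambda>i. empirical_mean f X W lag r s n i \<omega>) (\<lambda>i. i \<in> {1..M}) (isel n \<omega>)"
    and W_law: "\<And>k. k \<in> comparison_index M s \<Longrightarrow> W k \<in> P \<rightarrow>\<^sub>M N \<and> distr P N (W k) = N"
    and W_indep: "P.indep_vars (\<lambda>_. N) W (comparison_index M s)"
    and W_fresh:
      "P.indep_set (sets (solver_algebra P D M X)) (sets (comparison_algebra P N M s W))"

end

theory Submission
  imports Defs
begin

text \<open>
  If every empirical mean of the \<open>n\<close>-th comparison is within \<open>\<epsilon> (lag (r n))\<close> of its expectation, the
  selected solver is within \<open>2 * \<epsilon> (lag (r n))\<close> of the best one at the lagged time \<open>lag (r n)\<close>, and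
  for large \<open>n\<close> the property \<open>P_as\<close> carries this bound over to time \<open>r n\<close>. Whether \<open>P_as\<close> has taken
  effect between \<open>lag (r n)\<close> and \<open>r n\<close> depends on the solvers' trajectories only; since the comparison
  noise is independent of these, Fubini and Chebyshev's inequality bound the probability of a large
  deviation given the trajectories by \<open>M / (s n * (\<epsilon> (lag (r n)))\<^sup>2)\<close>. Summability of these bounds
  and the Borel-Cantelli lemma give the almost sure statement.
\<close>

section \<open>Probabilistic tools: second moments, product laws, conditional probabilities\<close>

text \<open>Each new summand is centered and independent of the sum of the earlier ones, so the
  cross term in the expanded square has expectation 0 and the second moments add up. Integrability
  is carried along because the integral of a non-integrable function is 0 by convention, so the
  inequality alone would say too little.\<close>

lemma (in prob_space) centered_indep_sum_second_moment:
  fixes Z :: "'i \<Rightarrow> 'a \<Rightarrow> real"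
  assumes "finite J" and "indep_vars (\<lambda>_. borel) Z J"
    and "\<And>j. j \<in> J \<Longrightarrow> integrable M (Z j)"
    and "\<And>j. j \<in> J \<Longrightarrow> integrable M (\<lambda>\<omega>. (Z j \<omega>)\<^sup>2)"
    and "\<And>j. j \<in> J \<Longrightarrow> expectation (Z j) = 0"
    and "\<And>j. j \<in> J \<Longrightarrow> expectation (\<lambda>\<omega>. (Z j \<omega>)\<^sup>2) \<le> v"
  shows "integrable M (\<lambda>\<omega>. (\<Sum>j\<in>J. Z j \<omega>)\<^sup>2) \<and>
    expectation (\<lambda>\<omega>. (\<Sum>j\<in>J. Z j \<omega>)\<^sup>2) \<le> real (card J) * v"
  using assms
proof (induction J rule: finite_induct)
  case empty
  then show ?case by simp
next
  case (insert i J)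
  let ?S = "\<lambda>\<omega>. \<Sum>j\<in>J. Z j \<omega>"
  have IH: "integrable M (\<lambda>\<omega>. (?S \<omega>)\<^sup>2)" "expectation (\<lambda>\<omega>. (?S \<omega>)\<^sup>2) \<le> real (card J) * v"
    using insert.IH[OF indep_vars_subset[OF insert.prems(1)]] insert.prems by auto
  have ind: "indep_var borel (Z i) borel ?S"
    by (rule indep_vars_sum[OF insert.hyps insert.prems(1)])
  have Zi: "integrable M (Z i)" and S: "integrable M ?S"
    using insert.prems(2) by auto
  have cross: "integrable M (\<lambda>\<omega>. Z i \<omega> * ?S \<omega>)" "expectation (\<lambda>\<omega>. Z i \<omega> * ?S \<omega>) = 0"
    by (rule indep_var_integrable[OF ind Zi S])
       (simp only: indep_var_lebesgue_integral[OF ind Zi S] insert.prems(4)[OF insertI1] mult_zero_left)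
  have expand: "(\<Sum>j\<in>insert i J. Z j \<omega>)\<^sup>2 = (Z i \<omega>)\<^sup>2 + 2 * (Z i \<omega> * ?S \<omega>) + (?S \<omega>)\<^sup>2" for \<omega>
    using insert.hyps by (simp add: power2_sum)
  have Zi2: "integrable M (\<lambda>\<omega>. (Z i \<omega>)\<^sup>2)" "expectation (\<lambda>\<omega>. (Z i \<omega>)\<^sup>2) \<le> v"
    using insert.prems(3,5) by auto
  have "expectation (\<lambda>\<omega>. (Z i \<omega>)\<^sup>2 + 2 * (Z i \<omega> * ?S \<omega>) + (?S \<omega>)\<^sup>2)
      = expectation (\<lambda>\<omega>. (Z i \<omega>)\<^sup>2) + expectation (\<lambda>\<omega>. (?S \<omega>)\<^sup>2)"
    using Zi2 cross IH by simp
  also have "\<dots> \<le> real (card (insert i J)) * v"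
    using Zi2(2) IH(2) insert.hyps by (simp add: algebra_simps)
  finally have "expectation (\<lambda>\<omega>. (Z i \<omega>)\<^sup>2 + 2 * (Z i \<omega> * ?S \<omega>) + (?S \<omega>)\<^sup>2) \<le> \<dots>" .
  moreover have "integrable M (\<lambda>\<omega>. (Z i \<omega>)\<^sup>2 + 2 * (Z i \<omega> * ?S \<omega>) + (?S \<omega>)\<^sup>2)"
    using Zi2 cross IH by simp
  ultimately show ?case
    unfolding expand by blast
qed

text \<open>Independence of the generated algebras is the product rule on measurable rectangles, and
  a product of sigma-finite measures is determined by its values there. This is what opens the way
  to Fubini.\<close>

lemma (in prob_space) pair_distr_eq_if_indep_vimage_algebras:
  assumes X: "X \<in> M \<rightarrow>\<^sub>M S" and Y: "Y \<in> M \<rightarrow>\<^sub>M T"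
    and ind: "indep_set (sets (vimage_algebra (space M) X S)) (sets (vimage_algebra (space M) Y T))"
  shows "distr M S X \<Otimes>\<^sub>M distr M T Y = distr M (S \<Otimes>\<^sub>M T) (\<lambda>\<omega>. (X \<omega>, Y \<omega>))"
proof -
  note [measurable] = X Y
  interpret X: prob_space "distr M S X" by (rule prob_space_distr) fact
  interpret Y: prob_space "distr M T Y" by (rule prob_space_distr) fact
  show ?thesis
  proof (rule pair_measure_eqI[OF X.sigma_finite_measure_axioms Y.sigma_finite_measure_axioms])
    fix A B assume "A \<in> sets (distr M S X)" "B \<in> sets (distr M T Y)"
    then have [measurable]: "A \<in> sets S" "B \<in> sets T" by simp_all
    have "prob ((X -` A \<inter> space M) \<inter> (Y -` B \<inter> space M))
        = prob (X -` A \<inter> space M) * prob (Y -` B \<inter> space M)"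
      using ind unfolding indep_sets2_eq by (blast intro: in_vimage_algebra \<open>A \<in> sets S\<close> \<open>B \<in> sets T\<close>)
    moreover have "(\<lambda>\<omega>. (X \<omega>, Y \<omega>)) -` (A \<times> B) \<inter> space M
        = (X -` A \<inter> space M) \<inter> (Y -` B \<inter> space M)"
      by auto
    ultimately show "emeasure (distr M S X) A * emeasure (distr M T Y) B
        = emeasure (distr M (S \<Otimes>\<^sub>M T) (\<lambda>\<omega>. (X \<omega>, Y \<omega>))) (A \<times> B)"
      by (simp add: emeasure_distr emeasure_eq_measure ennreal_mult)
  qed simp
qed

text \<open>Test the hypothesis on the part \<open>B\<close> of \<open>H\<close> where the
  conditional probability is below \<open>d\<close>. There \<open>d\<close> minus the conditional
  probability is positive, yet its integral over \<open>B\<close> is at most 0, so \<open>B\<close>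
  is a null set.\<close>

lemma (in finite_measure_subalgebra) real_cond_exp_indicator_ge:
  assumes A: "A \<in> sets M" and H: "H \<in> sets F"
    and le: "\<And>B. B \<in> sets F \<Longrightarrow> B \<subseteq> H \<Longrightarrow> d * measure M B \<le> measure M (B \<inter> A)"
  shows "AE x in M. x \<in> H \<longrightarrow> d \<le> real_cond_exp M F (indicator A) x"
proof -
  let ?h = "real_cond_exp M F (indicator A) :: 'a \<Rightarrow> real"
  have [measurable]: "?h \<in> borel_measurable F" "A \<in> sets M"
    by (auto simp: A)
  have intA: "integrable M (indicator A :: 'a \<Rightarrow> real)"
    using A emeasure_finite by (simp add: less_top[symmetric])
  define B where "B = {x \<in> space F. ?h x < d} \<inter> H"
  have BF: "B \<in> sets F"
    unfolding B_def using H by measurable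
  have BM: "B \<in> sets M"
    using BF subalg by (auto simp: subalgebra_def)
  have hB: "integrable M (\<lambda>x. indicator B x * ?h x)"
    using integrable_mult_indicator[OF BM real_cond_exp_int(1)[OF intA]] by simp
  have cB: "integrable M (\<lambda>x. indicator B x * d)"
    using BM emeasure_finite by (simp add: less_top[symmetric])
  \<comment> \<open>The defining property of conditional expectation applies because
    \<open>B\<close> lies in the subalgebra \<open>F\<close>.\<close>
  have "(\<integral>x. indicator B x * ?h x \<partial>M) = (\<integral>x. indicator B x * indicator A x \<partial>M)"
    using real_cond_exp_intA[OF intA BF] by (simp add: set_lebesgue_integral_def)
  also have "\<dots> = measure M (B \<inter> A)"
    using BM A by (simp add: indicator_inter_arith[symmetric] Int_absorb2 sets.sets_into_space)
  finally have "(\<integral>x. indicator B x * ?h x \<partial>M) = measure M (B \<inter> A)" .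
  moreover have "(\<integral>x. indicator B x * d \<partial>M) = d * measure M B"
    using BM by (simp add: sets.sets_into_space Int_absorb2)
  moreover have "(\<integral>x. indicator B x * d - indicator B x * ?h x \<partial>M)
      = (\<integral>x. indicator B x * d \<partial>M) - (\<integral>x. indicator B x * ?h x \<partial>M)"
    by (rule Bochner_Integration.integral_diff[OF cB hB])
  moreover have "d * measure M B \<le> measure M (B \<inter> A)"
    by (rule le[OF BF]) (simp add: B_def)
  ultimately have int: "(\<integral>x. indicator B x * d - indicator B x * ?h x \<partial>M) \<le> 0"
    by linarith
  have nonneg: "0 \<le> indicator B x * d - indicator B x * ?h x" for x
    by (auto simp: B_def indicator_def)
  have "(\<integral>x. indicator B x * d - indicator B x * ?h x \<partial>M) = 0"
    using int by (intro antisym Bochner_Integration.integral_nonneg nonneg) simp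
  then have "AE x in M. indicator B x * d - indicator B x * ?h x = 0"
    using integral_nonneg_eq_0_iff_AE[OF Bochner_Integration.integrable_diff[OF cB hB]] nonneg
    by auto
  then show ?thesis
    using AE_space
  proof eventually_elim
    case (elim x)
    moreover have "space F = space M"
      using subalg by (simp add: subalgebra_def)
    ultimately show ?case
      by (auto simp: B_def indicator_def split: if_splits)
  qed
qed

section \<open>Deviations of the empirical mean at a fixed point\<close>

context nopa
begin

text \<open>The centre is itself random: it averages over the noise only, at the point which the
  solver happens to recommend. The inequality is non-strict so that its failure gives the strict
  bounds that the regret estimate requires.\<close>

definition deviation :: "nat \<Rightarrow> nat \<Rightarrow> real \<Rightarrow> 'o set" where
  "deviation n i a = {\<omega> \<in> space P.
     a \<le> \<bar>empirical_mean f X W lag r s n i \<omega> - (\<integral>w. f (X i (lag (r n)) \<omega>) w \<partial>N)\<bar>}"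

lemma X_in: "i \<in> {1..M} \<Longrightarrow> 1 \<le> n \<Longrightarrow> \<omega> \<in> space P \<Longrightarrow> X i n \<omega> \<in> D"
  using measurable_space[OF X_measurable] by (simp add: space_restrict_space)

lemma lag_r_bounds: "1 \<le> n \<Longrightarrow> 1 \<le> lag (r n)" "1 \<le> n \<Longrightarrow> lag (r n) \<le> r n"
  using lag_function r_pos by (auto simp: lag_function_def)

lemma expectation_measurable [measurable]:
  "(\<lambda>x. \<integral>w. f x w \<partial>N) \<in> borel_measurable (restrict_space borel D)"
  using f_measurable by (rule N.borel_measurable_lebesgue_integral)

lemma f_measurable_point: "x \<in> D \<Longrightarrow> f x \<in> borel_measurable N"
  using f_integrable by blast

text \<open>Chebyshev's inequality: the \<open>s n\<close> centered evaluations are independent with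
  second moment at most 1, so their sum has second moment at most \<open>s n\<close>. The point is
  frozen so that each summand depends on one noise variable only.\<close>

lemma fixed_point_deviation:
  assumes x: "x \<in> D" and n: "1 \<le> n" and i: "i \<in> {1..M}" and a: "0 < a"
    and sq: "integrable N (\<lambda>w. (f x w)\<^sup>2)"
    and var: "(\<integral>w. (f x w - (\<integral>v. f x v \<partial>N))\<^sup>2 \<partial>N) \<le> 1"
  shows "P.prob {\<omega> \<in> space P.
      a \<le> \<bar>(1 / real (s n)) * (\<Sum>j=1..s n. f x (W (n, i, j) \<omega>)) - (\<integral>w. f x w \<partial>N)\<bar>}
    \<le> 1 / (real (s n) * a\<^sup>2)"
proof -
  let ?\<mu> = "\<integral>w. f x w \<partial>N"
  let ?J = "(\<lambda>j. (n, i, j)) ` {1..s n}"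
  let ?Z = "\<lambda>k \<omega>. f x (W k \<omega>) - ?\<mu>"
  let ?S = "\<lambda>\<omega>. \<Sum>k\<in>?J. ?Z k \<omega>"
  have s: "0 < s n"
    using s_pos[OF n] by simp
  have inj: "inj_on (\<lambda>j. (n, i, j)) {1..s n}"
    by (simp add: inj_on_def)
  have sub: "?J \<subseteq> comparison_index M s"
    using n i by (auto simp: comparison_index_def)
  have law: "W k \<in> P \<rightarrow>\<^sub>M N" "distr P N (W k) = N" if "k \<in> ?J" for k
    using W_law that sub by auto
  note [measurable] = f_measurable_point[OF x]
  \<comment> \<open>Since \<open>W k\<close> has law \<open>N\<close>, moments of an evaluation
    under \<open>P\<close> become moments under \<open>N\<close>, where the assumptions on
    \<open>f\<close> live.\<close>
  have transfer: "integrable N g \<Longrightarrow> integrable P (\<lambda>\<omega>. g (W k \<omega>))"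
      "(\<integral>\<omega>. g (W k \<omega>) \<partial>P) = (\<integral>w. g w \<partial>N)"
    if "k \<in> ?J" "g \<in> borel_measurable N" for k and g :: "'w \<Rightarrow> real"
    using integrable_distr_eq[OF law(1)[OF that(1)], of g]
      integral_distr[OF law(1)[OF that(1)], of g] law(2)[OF that(1)] that(2) by auto
  have c: "integrable N (\<lambda>w. f x w - ?\<mu>)" "(\<integral>w. f x w - ?\<mu> \<partial>N) = 0"
    using f_integrable[OF x] by (auto simp: N.prob_space)
  have c2: "integrable N (\<lambda>w. (f x w - ?\<mu>)\<^sup>2)"
    using sq f_integrable[OF x] by (simp add: power2_diff)
  have ind: "P.indep_vars (\<lambda>_. borel) ?Z ?J"
    by (rule P.indep_vars_compose2[OF P.indep_vars_subset[OF W_indep sub]]) measurable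
  have S2: "integrable P (\<lambda>\<omega>. (?S \<omega>)\<^sup>2) \<and>
      P.expectation (\<lambda>\<omega>. (?S \<omega>)\<^sup>2) \<le> real (card ?J) * 1"
  proof (rule P.centered_indep_sum_second_moment[OF _ ind])
    fix k assume k: "k \<in> ?J"
    show "integrable P (?Z k)" "integrable P (\<lambda>\<omega>. (?Z k \<omega>)\<^sup>2)"
      by (rule transfer(1)[OF k _ c(1)] transfer(1)[OF k _ c2], measurable)+
    show "P.expectation (?Z k) = 0"
      using transfer(2)[OF k, of "\<lambda>w. f x w - ?\<mu>"] c(2) by simp
    show "P.expectation (\<lambda>\<omega>. (?Z k \<omega>)\<^sup>2) \<le> 1"
      using transfer(2)[OF k, of "\<lambda>w. (f x w - ?\<mu>)\<^sup>2"] var by simp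
  qed simp
  then have S2: "integrable P (\<lambda>\<omega>. (?S \<omega>)\<^sup>2)" "P.expectation (\<lambda>\<omega>. (?S \<omega>)\<^sup>2) \<le> real (s n)"
    using card_image[OF inj] by simp_all
  have Sm: "?S \<in> borel_measurable P"
    using law(1) by (intro borel_measurable_sum borel_measurable_diff)
      (auto intro: measurable_compose[OF _ f_measurable_point[OF x]])
  have eq: "(1 / real (s n)) * (\<Sum>j=1..s n. f x (W (n, i, j) \<omega>)) - ?\<mu> = ?S \<omega> / real (s n)" for \<omega>
    using s by (simp only: sum.reindex[OF inj] comp_def sum_subtractf) (simp add: field_simps)
  have "P.prob {\<omega> \<in> space P. a \<le> \<bar>?S \<omega> / real (s n)\<bar>}
      = P.prob {\<omega> \<in> space P. real (s n) * a \<le> \<bar>?S \<omega>\<bar>}"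
    using s by (simp add: abs_divide pos_le_divide_eq mult.commute)
  also have "\<dots> \<le> P.expectation (\<lambda>\<omega>. (?S \<omega>)\<^sup>2) / (real (s n) * a)\<^sup>2"
    using s a by (intro P.second_moment_method[OF Sm S2(1)]) simp
  also have "\<dots> \<le> real (s n) / (real (s n) * a)\<^sup>2"
    using S2(2) by (intro divide_right_mono) auto
  also have "\<dots> = 1 / (real (s n) * a\<^sup>2)"
    using s a by (simp add: power2_eq_square)
  finally show ?thesis
    unfolding eq .
qed


section \<open>Separating the trajectories from the comparison noise\<close>

lemma trajectory_measurable: "trajectory M X \<in> P \<rightarrow>\<^sub>M trajectory_space D M"
  unfolding trajectory_def by (rule measurable_restrict) (auto intro: X_measurable)

lemma comparison_measurable:
  "(\<lambda>\<omega>. \<lambda>k\<in>comparison_index M s. W k \<omega>) \<in> P \<rightarrow>\<^sub>M PiM (comparison_index M s) (\<lambda>_. N)"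
  by (rule measurable_restrict) (use W_law in auto)

lemma solver_subalgebra: "subalgebra P (solver_algebra P D M X)"
  unfolding subalgebra_def solver_algebra_def
  using sets_image_in_sets[OF refl trajectory_measurable] by simp

sublocale S: finite_measure_subalgebra P "solver_algebra P D M X"
  by unfold_locales (rule solver_subalgebra)

text \<open>Each point is a coordinate of the trajectory, which generates the algebra. Measurability
  with respect to this smaller algebra, and not only to \<open>P\<close>, is what later permits
  conditioning on events about regrets.\<close>

lemma X_solver_measurable [measurable]:
  assumes "i \<in> {1..M}" "1 \<le> n"
  shows "X i n \<in> solver_algebra P D M X \<rightarrow>\<^sub>M restrict_space borel D"
proof -
  have "trajectory M X \<in> solver_algebra P D M X \<rightarrow>\<^sub>M trajectory_space D M"
    unfolding solver_algebra_def
    using measurable_space[OF trajectory_measurable] by (intro measurable_vimage_algebra1) auto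
  then have "(\<lambda>\<omega>. trajectory M X \<omega> (i, n)) \<in> solver_algebra P D M X \<rightarrow>\<^sub>M restrict_space borel D"
    by (rule measurable_compose[OF _ measurable_component_singleton]) (use assms in auto)
  then show ?thesis
    using assms by (simp add: trajectory_def)
qed

text \<open>This is \<open>W_fresh\<close> in the form that Fubini can use.\<close>

lemma solvers_comparisons_distr:
  "distr P (trajectory_space D M) (trajectory M X) \<Otimes>\<^sub>M
     distr P (PiM (comparison_index M s) (\<lambda>_. N)) (\<lambda>\<omega>. \<lambda>k\<in>comparison_index M s. W k \<omega>) =
   distr P (trajectory_space D M \<Otimes>\<^sub>M PiM (comparison_index M s) (\<lambda>_. N))
     (\<lambda>\<omega>. (trajectory M X \<omega>, \<lambda>k\<in>comparison_index M s. W k \<omega>))"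
  using W_fresh unfolding solver_algebra_def comparison_algebra_def
  by (rule P.pair_distr_eq_if_indep_vimage_algebras[OF trajectory_measurable comparison_measurable])

text \<open>By Fubini the noise is integrated first, with the trajectory frozen, where
  \<open>fixed_point_deviation\<close> applies; integrating over the trajectories in
  \<open>F\<close> then yields the factor \<open>P.prob F\<close>. Having the bound for every such
  \<open>F\<close> makes it a bound on the conditional probability.\<close>

lemma deviation_given_solvers:
  assumes n: "1 \<le> n" and i: "i \<in> {1..M}" and a: "0 < a"
    and var: "\<And>x. x \<in> D \<Longrightarrow> integrable N (\<lambda>w. (f x w)\<^sup>2) \<and>
      (\<integral>w. (f x w - (\<integral>v. f x v \<partial>N))\<^sup>2 \<partial>N) \<le> 1"
    and F: "F \<in> sets (solver_algebra P D M X)"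
  shows "deviation n i a \<in> sets P"
    and "P.prob (F \<inter> deviation n i a) \<le> 1 / (real (s n) * a\<^sup>2) * P.prob F"
proof -
  let ?K = "comparison_index M s"
  let ?TS = "trajectory_space D M" and ?CS = "PiM ?K (\<lambda>_. N)"
  let ?T = "trajectory M X" and ?V = "\<lambda>\<omega>. \<lambda>k\<in>?K. W k \<omega>"
  let ?L = "lag (r n)"
  let ?dev = "\<lambda>x v. \<bar>(1 / real (s n)) * (\<Sum>j=1..s n. f x (v (n, i, j))) - (\<integral>w. f x w \<partial>N)\<bar>"
  \<comment> \<open>The deviation event transported to pairs of a trajectory and a noise family;
    \<open>deviation n i a\<close> is its preimage.\<close>
  define C where "C = {p \<in> space (?TS \<Otimes>\<^sub>M ?CS). a \<le> ?dev (fst p (i, ?L)) (snd p)}"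
  have iL: "(i, ?L) \<in> {1..M} \<times> {1..}"
    using i lag_r_bounds[OF n] by auto
  have idx: "(n, i, j) \<in> ?K" if "j \<in> {1..s n}" for j
    using that n i by (auto simp: comparison_index_def)
  note [measurable] = trajectory_measurable comparison_measurable
  have pt: "(\<lambda>p. fst p (i, ?L)) \<in> ?TS \<Otimes>\<^sub>M ?CS \<rightarrow>\<^sub>M restrict_space borel D"
    by (rule measurable_compose[OF measurable_fst measurable_component_singleton[OF iL]])
  have noise: "(\<lambda>p. snd p (n, i, j)) \<in> ?TS \<Otimes>\<^sub>M ?CS \<rightarrow>\<^sub>M N" if "j \<in> {1..s n}" for j
    by (rule measurable_compose[OF measurable_snd measurable_component_singleton[OF idx[OF that]]])
  have "(\<lambda>p. f (fst p (i, ?L)) (snd p (n, i, j))) \<in> borel_measurable (?TS \<Otimes>\<^sub>M ?CS)"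
    if "j \<in> {1..s n}" for j
    using measurable_compose[OF measurable_Pair[OF pt noise[OF that]] f_measurable] by simp
  moreover have "(\<lambda>p. \<integral>w. f (fst p (i, ?L)) w \<partial>N) \<in> borel_measurable (?TS \<Otimes>\<^sub>M ?CS)"
    by (rule measurable_compose[OF pt expectation_measurable])
  ultimately have "(\<lambda>p. ?dev (fst p (i, ?L)) (snd p)) \<in> borel_measurable (?TS \<Otimes>\<^sub>M ?CS)"
    by (intro borel_measurable_abs borel_measurable_diff borel_measurable_times
        borel_measurable_const borel_measurable_sum) auto
  then have C: "C \<in> sets (?TS \<Otimes>\<^sub>M ?CS)"
    unfolding C_def by measurable
  have emp: "empirical_mean f X W lag r s n i \<omega>
      = (1 / real (s n)) * (\<Sum>j=1..s n. f (?T \<omega> (i, ?L)) (?V \<omega> (n, i, j)))"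
    if "\<omega> \<in> space P" for \<omega>
    using iL idx by (simp add: empirical_mean_def trajectory_def)
  have Teq: "?T \<omega> (i, ?L) = X i ?L \<omega>" for \<omega>
    using iL by (simp add: trajectory_def)
  have TV: "(\<lambda>\<omega>. (?T \<omega>, ?V \<omega>)) \<in> P \<rightarrow>\<^sub>M ?TS \<Otimes>\<^sub>M ?CS"
    by measurable
  have devC: "deviation n i a = (\<lambda>\<omega>. (?T \<omega>, ?V \<omega>)) -` C \<inter> space P"
    using measurable_space[OF TV] emp by (auto simp: deviation_def C_def Teq)
  show dev: "deviation n i a \<in> sets P"
    unfolding devC by (rule measurable_sets[OF TV C])
  obtain F' where F': "F' \<in> sets ?TS" "F = ?T -` F' \<inter> space P"
    using F measurable_space[OF trajectory_measurable]
    unfolding solver_algebra_def by (subst (asm) sets_vimage_algebra2) auto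
  define c where "c = 1 / (real (s n) * a\<^sup>2)"
  define G where "G = (F' \<times> space ?CS) \<inter> C"
  have G: "G \<in> sets (?TS \<Otimes>\<^sub>M ?CS)"
    using F'(1) C by (auto simp: G_def)
  interpret V: prob_space "distr P ?CS ?V"
    by (rule P.prob_space_distr) measurable
  \<comment> \<open>The slice of \<open>G\<close> at a frozen trajectory \<open>t\<close> is a
    fixed-point deviation if \<open>t\<close> lies in \<open>F'\<close>, and is empty
    otherwise.\<close>
  have Gt: "emeasure (distr P ?CS ?V) (Pair t -` G) \<le> ennreal c * indicator F' t" if t: "t \<in> space ?TS" for t
  proof (cases "t \<in> F'")
    case True
    have tD: "t (i, ?L) \<in> D"
      using measurable_space[OF measurable_component_singleton[OF iL] t]
      by (simp add: space_restrict_space)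
    have "Pair t -` G \<in> sets ?CS"
      using G by (rule sets_Pair1)
    then have "emeasure (distr P ?CS ?V) (Pair t -` G) = emeasure P (?V -` (Pair t -` G) \<inter> space P)"
      by (simp add: emeasure_distr)
    also have "?V -` (Pair t -` G) \<inter> space P =
        {\<omega> \<in> space P. a \<le> ?dev (t (i, ?L)) (\<lambda>k. W k \<omega>)}"
      using True t measurable_space[OF comparison_measurable] idx
      by (auto simp: G_def C_def space_pair_measure)
    also have "emeasure P \<dots> \<le> ennreal c"
      unfolding P.emeasure_eq_measure c_def
      using fixed_point_deviation[OF tD n i a] var[OF tD] by (intro ennreal_leI) auto
    finally show ?thesis
      using True by (simp only: indicator_simps mult_1_right)
  qed (auto simp: G_def)
  have "emeasure P (F \<inter> deviation n i a) = emeasure P ((\<lambda>\<omega>. (?T \<omega>, ?V \<omega>)) -` G \<inter> space P)"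
    using measurable_space[OF comparison_measurable]
    by (intro arg_cong[where f = "emeasure P"]) (auto simp: F'(2) devC G_def)
  also have "\<dots> = emeasure (distr P (?TS \<Otimes>\<^sub>M ?CS) (\<lambda>\<omega>. (?T \<omega>, ?V \<omega>))) G"
    by (rule emeasure_distr[OF TV G, symmetric])
  also have "\<dots> = emeasure (distr P ?TS ?T \<Otimes>\<^sub>M distr P ?CS ?V) G"
    by (simp only: solvers_comparisons_distr)
  also have "\<dots> = (\<integral>\<^sup>+t. emeasure (distr P ?CS ?V) (Pair t -` G) \<partial>distr P ?TS ?T)"
    using G by (intro V.emeasure_pair_measure_alt) simp
  also have "\<dots> \<le> (\<integral>\<^sup>+t. ennreal c * indicator F' t \<partial>distr P ?TS ?T)"
    using Gt by (intro nn_integral_mono) simp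
  also have "\<dots> = ennreal c * emeasure P F"
    using F' by (simp only: nn_integral_cmult_indicator sets_distr emeasure_distr[OF trajectory_measurable])
  finally show "P.prob (F \<inter> deviation n i a) \<le> 1 / (real (s n) * a\<^sup>2) * P.prob F"
    unfolding P.emeasure_eq_measure c_def by (simp add: ennreal_mult'[symmetric])
qed


section \<open>Regrets and the selected solver at the lagged time\<close>

lemma SR_eq:
  assumes "i \<in> {1..M}" "1 \<le> n" "\<omega> \<in> space P"
  shows "SR N f xstar X i n \<omega> = (\<integral>w. f (X i n \<omega>) w \<partial>N) - (\<integral>w. f xstar w \<partial>N)"
  using f_integrable[OF X_in[OF assms]] f_integrable[OF xstar_in]
  by (simp add: SR_def point_regret_def)

lemma SR_measurable:
  assumes "i \<in> {1..M}" "1 \<le> n"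
  shows "SR N f xstar X i n \<in> borel_measurable (solver_algebra P D M X)"
proof -
  have "(\<lambda>\<omega>. (\<integral>w. f (X i n \<omega>) w \<partial>N) - (\<integral>w. f xstar w \<partial>N))
      \<in> borel_measurable (solver_algebra P D M X)"
    using measurable_compose[OF X_solver_measurable[OF assms] expectation_measurable] by measurable
  then show ?thesis
    by (subst measurable_cong[OF SR_eq[OF assms]]) (simp_all add: solver_algebra_def)
qed

lemma SR_solvers_measurable:
  "1 \<le> n \<Longrightarrow> SR_solvers N f xstar M X n \<in> borel_measurable (solver_algebra P D M X)"
  unfolding SR_solvers_def[abs_def] by (intro borel_measurable_Min SR_measurable) auto

lemma isel_in: "1 \<le> n \<Longrightarrow> \<omega> \<in> space P \<Longrightarrow> isel n \<omega> \<in> {1..M}"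
  using isel_arg_min by (simp add: is_arg_min_linorder)

text \<open>Pass from the true mean of the selected solver to its empirical mean, then to that of
  the best solver, then to the true mean of the latter. The middle passage is the arg min property
  and each of the other two costs less than \<open>a\<close>; the value at \<open>xstar\<close>
  cancels.\<close>

lemma selected_gap_less:
  assumes n: "1 \<le> n" and \<omega>: "\<omega> \<in> space P"
    and dev: "\<And>i. i \<in> {1..M} \<Longrightarrow> \<omega> \<notin> deviation n i a"
  shows "regret_gap N f xstar M X (isel n \<omega>) (lag (r n)) \<omega> < 2 * a"
proof -
  let ?emp = "\<lambda>i. empirical_mean f X W lag r s n i \<omega>"
  let ?m = "\<lambda>i. \<integral>w. f (X i (lag (r n)) \<omega>) w \<partial>N"
  let ?SR = "\<lambda>i. SR N f xstar X i (lag (r n)) \<omega>"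
  have "Min (?SR ` {1..M}) \<in> ?SR ` {1..M}"
    using M_ge_2 by (intro Min_in) auto
  then obtain j where j: "j \<in> {1..M}" "Min (?SR ` {1..M}) = ?SR j"
    by auto
  note i = isel_in[OF n \<omega>]
  have close: "\<bar>?emp k - ?m k\<bar> < a" if "k \<in> {1..M}" for k
    using dev[OF that] \<omega> by (simp add: deviation_def)
  have "?emp (isel n \<omega>) \<le> ?emp j"
    using isel_arg_min[OF n \<omega>] j(1) by (simp add: is_arg_min_linorder)
  then have "?m (isel n \<omega>) - ?m j < 2 * a"
    using close[OF i] close[OF j(1)] by linarith
  then show ?thesis
    using SR_eq[OF i lag_r_bounds(1)[OF n] \<omega>] SR_eq[OF j(1) lag_r_bounds(1)[OF n] \<omega>] j(2)
    by (simp add: regret_gap_def SR_solvers_def)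
qed

section \<open>From the lagged time to the selection time\<close>

definition good_selection :: "(nat \<Rightarrow> real) \<Rightarrow> nat \<Rightarrow> 'o set" where
  "good_selection \<epsilon> n = {\<omega> \<in> space P. SR_selection N f xstar X r isel n \<omega>
     < SR_solvers N f xstar M X (r n) \<omega> + 2 * \<epsilon> (r n)}"

text \<open>The instance of \<open>P_as\<close> used at the \<open>n\<close>-th selection. It ranges
  over all solvers, and not just the selected one, because the selection depends on the comparison
  noise while this event must be determined by the trajectories.\<close>

definition stable_gaps :: "(nat \<Rightarrow> real) \<Rightarrow> nat \<Rightarrow> 'o set" where
  "stable_gaps \<epsilon> n = {\<omega> \<in> space P. \<forall>i\<in>{1..M}.
     regret_gap N f xstar M X i (lag (r n)) \<omega> < 2 * \<epsilon> (lag (r n)) \<longrightarrow>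
     regret_gap N f xstar M X i (r n) \<omega> < 2 * \<epsilon> (r n)}"

lemma good_selection_if_stable:
  assumes "1 \<le> n" "\<omega> \<in> stable_gaps \<epsilon> n"
    and "\<And>i. i \<in> {1..M} \<Longrightarrow> \<omega> \<notin> deviation n i (\<epsilon> (lag (r n)))"
  shows "\<omega> \<in> good_selection \<epsilon> n"
proof -
  have \<omega>: "\<omega> \<in> space P"
    using assms(2) by (simp add: stable_gaps_def)
  have "regret_gap N f xstar M X (isel n \<omega>) (r n) \<omega> < 2 * \<epsilon> (r n)"
    using assms(2) selected_gap_less[OF assms(1) \<omega> assms(3)] isel_in[OF assms(1) \<omega>]
    unfolding stable_gaps_def by blast
  then show ?thesis
    using \<omega> by (simp add: good_selection_def regret_gap_def SR_def SR_selection_def)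
qed

lemma stable_gaps_sets:
  assumes "1 \<le> n"
  shows "stable_gaps \<epsilon> n \<in> sets (solver_algebra P D M X)"
proof -
  have gap: "regret_gap N f xstar M X i m \<in> borel_measurable (solver_algebra P D M X)"
    if "i \<in> {1..M}" "1 \<le> m" for i m
    unfolding regret_gap_def[abs_def]
    using SR_measurable[OF that] SR_solvers_measurable[OF that(2)] by measurable
  note [measurable] = gap[OF _ lag_r_bounds(1)[OF assms]] gap[OF _ r_pos[OF assms]]
  have space: "space P = space (solver_algebra P D M X)"
    by (simp add: solver_algebra_def)
  show ?thesis
    unfolding stable_gaps_def space by measurable
qed

lemma good_selection_sets:
  assumes n: "1 \<le> n"
  shows "good_selection \<epsilon> n \<in> sets P"
proof -
  note [measurable] = measurable_from_subalg[OF solver_subalgebra SR_measurable[OF _ r_pos[OF n]]]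
    measurable_from_subalg[OF solver_subalgebra SR_solvers_measurable[OF r_pos[OF n]]]
    isel_measurable[OF n]
  \<comment> \<open>Splitting by the value of the random index leaves only regrets of fixed solvers,
    whose measurability is known.\<close>
  have "good_selection \<epsilon> n = (\<Union>i\<in>{1..M}. {\<omega> \<in> space P. isel n \<omega> = i \<and>
      SR N f xstar X i (r n) \<omega> < SR_solvers N f xstar M X (r n) \<omega> + 2 * \<epsilon> (r n)})"
    using isel_in[OF n] by (auto simp: good_selection_def SR_def SR_selection_def)
  also have "\<dots> \<in> sets P"
    by (intro sets.finite_UN) measurable
  finally show ?thesis .
qed

text \<open>The threshold in \<open>P_as\<close> is random, but \<open>lag (r n)\<close> eventually
  exceeds it. From then on \<open>P_as\<close> applies with \<open>lag (r n)\<close> as the earlier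
  time and \<open>r n\<close> as the later one.\<close>

lemma eventually_stable_gaps:
  assumes "P_as P N f xstar M X \<epsilon>"
    and "filterlim (\<lambda>n. lag (r n)) at_top sequentially"
  shows "AE \<omega> in P. \<forall>\<^sub>F n in sequentially. \<omega> \<in> stable_gaps \<epsilon> n"
proof -
  \<comment> \<open>\<open>P_as\<close> has one null set per solver; finitely many of them merge
    into one.\<close>
  have "AE \<omega> in P. \<forall>i\<in>{1..M}. \<exists>n0\<ge>1. \<forall>n1\<ge>n0.
        regret_gap N f xstar M X i n1 \<omega> < 2 * \<epsilon> n1 \<longrightarrow>
        (\<forall>n2\<ge>n1. regret_gap N f xstar M X i n2 \<omega> < 2 * \<epsilon> n2)"
    using assms(1) unfolding P_as_def by (intro AE_finite_allI) auto
  then show ?thesis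
    using AE_space
  proof eventually_elim
    case (elim \<omega>)
    have "\<forall>\<^sub>F n in sequentially. regret_gap N f xstar M X i (lag (r n)) \<omega> < 2 * \<epsilon> (lag (r n)) \<longrightarrow>
        regret_gap N f xstar M X i (r n) \<omega> < 2 * \<epsilon> (r n)" if i: "i \<in> {1..M}" for i
    proof -
      obtain n0 where n0: "\<And>n1 n2. n0 \<le> n1 \<Longrightarrow> n1 \<le> n2 \<Longrightarrow>
          regret_gap N f xstar M X i n1 \<omega> < 2 * \<epsilon> n1 \<Longrightarrow>
          regret_gap N f xstar M X i n2 \<omega> < 2 * \<epsilon> n2"
        using bspec[OF elim(1) i] by blast
      have "\<forall>\<^sub>F n in sequentially. n0 \<le> lag (r n)"
        using assms(2) unfolding filterlim_at_top by blast
      then show ?thesis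
        using eventually_ge_at_top[of 1]
        by eventually_elim (intro impI, rule n0[OF _ lag_r_bounds(2)])
    qed
    then have "\<forall>\<^sub>F n in sequentially. \<forall>i\<in>{1..M}.
        regret_gap N f xstar M X i (lag (r n)) \<omega> < 2 * \<epsilon> (lag (r n)) \<longrightarrow>
        regret_gap N f xstar M X i (r n) \<omega> < 2 * \<epsilon> (r n)"
      by (intro eventually_ball_finite) auto
    then show ?case
      using elim(2) by (simp add: stable_gaps_def)
  qed
qed

section \<open>Conditional bound and Borel-Cantelli\<close>

text \<open>The factor \<open>M\<close> comes from the union bound over the solvers.\<close>

lemma deviations_prob_le:
  assumes n: "1 \<le> n" and a: "0 < a"
    and var: "\<And>x. x \<in> D \<Longrightarrow> integrable N (\<lambda>w. (f x w)\<^sup>2) \<and>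
      (\<integral>w. (f x w - (\<integral>v. f x v \<partial>N))\<^sup>2 \<partial>N) \<le> 1"
    and F: "F \<in> sets (solver_algebra P D M X)"
  shows "P.prob (F \<inter> (\<Union>i\<in>{1..M}. deviation n i a)) \<le> real M / (real (s n) * a\<^sup>2) * P.prob F"
proof -
  have FP: "F \<in> sets P"
    using F solver_subalgebra by (auto simp: subalgebra_def)
  have "P.prob (F \<inter> (\<Union>i\<in>{1..M}. deviation n i a))
      \<le> (\<Sum>i\<in>{1..M}. P.prob (F \<inter> deviation n i a))"
    unfolding Int_UN_distrib using deviation_given_solvers(1)[OF n _ a var F] FP
    by (intro P.finite_measure_subadditive_finite) auto
  also have "\<dots> \<le> (\<Sum>i\<in>{1..M}. 1 / (real (s n) * a\<^sup>2) * P.prob F)"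
    by (intro sum_mono deviation_given_solvers(2)[OF n _ a var F])
  finally show ?thesis
    by simp
qed

text \<open>On an event \<open>B\<close> of the solver algebra inside \<open>stable_gaps\<close>, a
  sample point is a good selection or shows a deviation, and the deviations take up at most the
  stated fraction of \<open>B\<close>. This is the criterion of
  \<open>real_cond_exp_indicator_ge\<close>.\<close>

lemma prob_given_solvers_ge:
  assumes n: "1 \<le> n" and \<epsilon>: "0 < \<epsilon> (lag (r n))"
    and var: "\<And>x. x \<in> D \<Longrightarrow> integrable N (\<lambda>w. (f x w)\<^sup>2) \<and>
      (\<integral>w. (f x w - (\<integral>v. f x v \<partial>N))\<^sup>2 \<partial>N) \<le> 1"
  shows "AE \<omega> in P. \<omega> \<in> stable_gaps \<epsilon> n \<longrightarrow>
    1 - real M / (real (s n) * (\<epsilon> (lag (r n)))\<^sup>2)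
      \<le> prob_given_solvers P D M X (good_selection \<epsilon> n) \<omega>"
  unfolding prob_given_solvers_def
proof (rule S.real_cond_exp_indicator_ge[OF good_selection_sets[OF n] stable_gaps_sets[OF n]])
  fix B assume B: "B \<in> sets (solver_algebra P D M X)" "B \<subseteq> stable_gaps \<epsilon> n"
  let ?dev = "\<Union>i\<in>{1..M}. deviation n i (\<epsilon> (lag (r n)))"
  have BP: "B \<in> sets P"
    using B(1) solver_subalgebra by (auto simp: subalgebra_def)
  have dev: "?dev \<in> sets P"
    using deviation_given_solvers(1)[OF n _ \<epsilon> var B(1)] by auto
  have "P.prob B \<le> P.prob ((B \<inter> good_selection \<epsilon> n) \<union> (B \<inter> ?dev))"
    using good_selection_if_stable[OF n, of _ \<epsilon>] B(2) BP dev good_selection_sets[OF n]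
    by (intro P.finite_measure_mono) auto
  also have "\<dots> \<le> P.prob (B \<inter> good_selection \<epsilon> n) + P.prob (B \<inter> ?dev)"
    using BP dev good_selection_sets[OF n] by (intro measure_Un_le) auto
  also have "P.prob (B \<inter> ?dev) \<le> real M / (real (s n) * (\<epsilon> (lag (r n)))\<^sup>2) * P.prob B"
    by (rule deviations_prob_le[OF n \<epsilon> var B(1)])
  finally show "(1 - real M / (real (s n) * (\<epsilon> (lag (r n)))\<^sup>2)) * P.prob B
      \<le> P.prob (B \<inter> good_selection \<epsilon> n)"
    by (simp add: algebra_simps)
qed

text \<open>Up to the factor \<open>M\<close>, the summable series dominates the probabilities of
  the deviation events, so almost surely only finitely many of these occur. The events are indexed
  by \<open>Suc j\<close> since selections are numbered from 1.\<close>

lemma eventually_no_deviation: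
  assumes \<epsilon>: "\<And>n. 1 \<le> n \<Longrightarrow> 0 < \<epsilon> n"
    and var: "\<And>x. x \<in> D \<Longrightarrow> integrable N (\<lambda>w. (f x w)\<^sup>2) \<and>
      (\<integral>w. (f x w - (\<integral>v. f x v \<partial>N))\<^sup>2 \<partial>N) \<le> 1"
    and sum: "summable (\<lambda>j. 1 / (real (s (Suc j)) * (\<epsilon> (lag (r (Suc j))))\<^sup>2))"
  shows "AE \<omega> in P. \<forall>\<^sub>F n in sequentially. \<forall>i\<in>{1..M}. \<omega> \<notin> deviation n i (\<epsilon> (lag (r n)))"
proof -
  let ?A = "\<lambda>j. \<Union>i\<in>{1..M}. deviation (Suc j) i (\<epsilon> (lag (r (Suc j))))"
  \<comment> \<open>Taking the whole space as the conditioning event turns the bound given the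
    trajectories into an unconditional one.\<close>
  have space: "space P \<in> sets (solver_algebra P D M X)"
    using sets.top[of "solver_algebra P D M X"] by (simp add: solver_algebra_def)
  have pos: "0 < \<epsilon> (lag (r (Suc j)))" for j
    by (rule \<epsilon>[OF lag_r_bounds(1)]) simp
  have A: "?A j \<in> sets P" for j
    using deviation_given_solvers(1)[OF _ _ pos var space] by auto
  have "P.prob (?A j) \<le> real M * (1 / (real (s (Suc j)) * (\<epsilon> (lag (r (Suc j))))\<^sup>2))" for j
    using deviations_prob_le[OF _ pos var space, of "Suc j" j] sets.sets_into_space[OF A[of j]]
    by (simp add: P.prob_space Int_absorb1)
  then have "summable (\<lambda>j. P.prob (?A j))"
    by (intro summable_comparison_test'[OF summable_mult[OF sum]]) simp
  then have "AE \<omega> in P. \<forall>\<^sub>F j in sequentially. \<omega> \<in> space P - ?A j"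
    using A P.emeasure_finite by (intro borel_cantelli_AE1) (auto simp: less_top[symmetric])
  then show ?thesis
    by eventually_elim (subst eventually_sequentially_Suc[symmetric], auto elim: eventually_mono)
qed

section \<open>Counting the evaluations\<close>

text \<open>The labels split by constructor into \<open>M * r n\<close> solver calls and
  \<open>M * s k\<close> comparison calls for each selection \<open>k\<close>. Factoring out
  \<open>r n\<close> uses that it is nonzero.\<close>

lemma card_nopa_evaluations:
  assumes "1 \<le> n"
  shows "real (card (nopa_evaluations M r s n))
    = real (r n) * real M * (1 + (\<Sum>i=1..n. real (s i) / real (r n)))"
proof -
  let ?S = "(\<lambda>(i, m). Solver_Eval i m) ` ({1..M} \<times> {1..r n})"
  let ?C = "(\<lambda>(k, i, j). Comparison_Eval k i j) ` (SIGMA k:{1..n}. {1..M} \<times> {1..s k})"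
  have eq: "nopa_evaluations M r s n = ?S \<union> ?C"
    unfolding nopa_evaluations_def comparison_index_def by (force simp: image_iff)
  have "card (?S \<union> ?C) = card ?S + card ?C"
    by (rule card_Un_disjoint) auto
  also have "card ?S = M * r n"
    by (subst card_image) (auto simp: inj_on_def)
  also have "card ?C = (\<Sum>k=1..n. M * s k)"
    by (subst card_image) (auto simp: inj_on_def)
  finally have "real (card (nopa_evaluations M r s n)) = real M * (real (r n) + (\<Sum>i=1..n. real (s i)))"
    unfolding eq by (simp add: sum_distrib_left distrib_left)
  moreover have "(\<Sum>i=1..n. real (s i) / real (r n)) = (\<Sum>i=1..n. real (s i)) / real (r n)"
    by (rule sum_divide_distrib[symmetric])
  moreover have "real (r n) \<noteq> 0"
    using r_pos[OF assms] by simp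
  ultimately show ?thesis
    by (simp add: distrib_left)
qed

end

section \<open>The two guarantees for the portfolio\<close>

text \<open>The threshold in \<open>P_as\<close> varies with the trajectories, so the first bound is
  stated conditionally on them, with \<open>n0\<close> depending on the sample point. Divergence of
  \<open>lag (r n)\<close> makes the lagged times pass that threshold.\<close>

theorem theorem1:
  fixes P :: "'o measure" and N :: "'w measure"
    and D :: "(real ^ 'd) set" and f :: "real ^ 'd \<Rightarrow> 'w \<Rightarrow> real" and xstar :: "real ^ 'd"
    and M :: nat and X :: "nat \<Rightarrow> nat \<Rightarrow> 'o \<Rightarrow> real ^ 'd"
    and W :: "nat \<times> nat \<times> nat \<Rightarrow> 'o \<Rightarrow> 'w"
    and lag r s :: "nat \<Rightarrow> nat" and isel :: "nat \<Rightarrow> 'o \<Rightarrow> nat"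
    and \<epsilon> :: "nat \<Rightarrow> real"
  assumes nopa: "nopa P N D f xstar M X W lag r s isel"
    and lag_r_unbounded: "filterlim (\<lambda>n. lag (r n)) at_top sequentially"
    and variance: "\<And>x. x \<in> D \<Longrightarrow> integrable N (\<lambda>w. (f x w)\<^sup>2) \<and>
      (\<integral>w. (f x w - (\<integral>v. f x v \<partial>N))\<^sup>2 \<partial>N) \<le> 1"
    and eps_pos: "\<And>n. 1 \<le> n \<Longrightarrow> 0 < \<epsilon> n"
    and P_as: "P_as P N f xstar M X \<epsilon>"
  shows
    "(AE \<omega> in P. \<exists>n0\<ge>1. \<forall>n\<ge>n0.
        prob_given_solvers P D M X
          {\<omega>' \<in> space P. SR_selection N f xstar X r isel n \<omega>'
                          < SR_solvers N f xstar M X (r n) \<omega>' + 2 * \<epsilon> (r n)} \<omega>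
        \<ge> 1 - real M / (real (s n) * (\<epsilon> (lag (r n)))\<^sup>2)
      \<and> real (card (nopa_evaluations M r s n))
          = real (r n) * real M * (1 + (\<Sum>i=1..n. real (s i) / real (r n))))
   \<and> (summable (\<lambda>j. 1 / (real (s (Suc j)) * (\<epsilon> (lag (r (Suc j))))\<^sup>2)) \<longrightarrow>
      (AE \<omega> in P. \<exists>n0\<ge>1. \<forall>n\<ge>n0.
        SR_selection N f xstar X r isel n \<omega>
          < SR_solvers N f xstar M X (r n) \<omega> + 2 * \<epsilon> (r n)
      \<and> real (card (nopa_evaluations M r s n))
          = real (r n) * real M * (1 + (\<Sum>i=1..n. real (s i) / real (r n)))))"
proof -
  interpret nopa P N D f xstar M X W lag r s isel
    by (rule nopa)
  note stable = eventually_stable_gaps[OF P_as lag_r_unbounded]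
  have "AE \<omega> in P. \<omega> \<in> stable_gaps \<epsilon> n \<longrightarrow>
      1 - real M / (real (s n) * (\<epsilon> (lag (r n)))\<^sup>2)
        \<le> prob_given_solvers P D M X (good_selection \<epsilon> n) \<omega>" if "n \<in> {1..}" for n
    using that by (intro prob_given_solvers_ge eps_pos lag_r_bounds(1) variance) simp_all
  \<comment> \<open>A version of the conditional probability is fixed for each \<open>n\<close>; the
    countably many null sets are merged before \<open>n0\<close> is chosen.\<close>
  then have "AE \<omega> in P. \<forall>n\<in>{1..}. \<omega> \<in> stable_gaps \<epsilon> n \<longrightarrow>
      1 - real M / (real (s n) * (\<epsilon> (lag (r n)))\<^sup>2)
        \<le> prob_given_solvers P D M X (good_selection \<epsilon> n) \<omega>"
    by (subst AE_ball_countable) simp_all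
  then have first: "AE \<omega> in P. \<exists>n0\<ge>1. \<forall>n\<ge>n0.
      1 - real M / (real (s n) * (\<epsilon> (lag (r n)))\<^sup>2)
        \<le> prob_given_solvers P D M X (good_selection \<epsilon> n) \<omega>"
    using stable
  proof eventually_elim
    case (elim \<omega>)
    then obtain n0 where "\<And>n. n0 \<le> n \<Longrightarrow> \<omega> \<in> stable_gaps \<epsilon> n"
      by (auto simp: eventually_sequentially)
    \<comment> \<open>The threshold is raised to 1 because the conditional bounds are available for
      positive indices only.\<close>
    then show ?case
      using elim(1) by (intro exI[of _ "max 1 n0"]) simp
  qed
  have second: "AE \<omega> in P. \<exists>n0\<ge>1. \<forall>n\<ge>n0. \<omega> \<in> good_selection \<epsilon> n"
    if "summable (\<lambda>j. 1 / (real (s (Suc j)) * (\<epsilon> (lag (r (Suc j))))\<^sup>2))"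
  proof -
    have "AE \<omega> in P. \<forall>\<^sub>F n in sequentially. \<forall>i\<in>{1..M}. \<omega> \<notin> deviation n i (\<epsilon> (lag (r n)))"
      by (rule eventually_no_deviation) (erule eps_pos variance | rule that)+
    with stable show ?thesis
    proof eventually_elim
      case (elim \<omega>)
      then have "\<forall>\<^sub>F n in sequentially. \<omega> \<in> good_selection \<epsilon> n"
        using eventually_ge_at_top[of 1]
        by eventually_elim (blast intro: good_selection_if_stable)
      then obtain n0 where "\<And>n. n0 \<le> n \<Longrightarrow> \<omega> \<in> good_selection \<epsilon> n"
        by (auto simp: eventually_sequentially)
      then show ?case
        by (intro exI[of _ "max 1 n0"]) simp
    qed
  qed
  \<comment> \<open>The evaluation count is deterministic and valid for every positive
    \<open>n\<close>, so it can be attached to either conclusion with the same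
    \<open>n0\<close>.\<close>
  have with_card: "\<exists>n0\<ge>1. \<forall>n\<ge>n0. Q n \<and> real (card (nopa_evaluations M r s n))
      = real (r n) * real M * (1 + (\<Sum>i=1..n. real (s i) / real (r n)))"
    if Q: "\<exists>n0\<ge>1. \<forall>n\<ge>n0. Q n" for Q
  proof -
    obtain n0 where n0: "1 \<le> n0" "\<forall>n\<ge>n0. Q n"
      using Q by blast
    have "Q n \<and> real (card (nopa_evaluations M r s n))
      = real (r n) * real M * (1 + (\<Sum>i=1..n. real (s i) / real (r n)))" if "n0 \<le> n" for n
      using card_nopa_evaluations[OF order_trans[OF n0(1) that]] n0(2) that by simp
    then show ?thesis
      using n0(1) by blast
  qed
  show ?thesis
  proof (intro conjI impI)
    show "AE \<omega> in P. \<exists>n0\<ge>1. \<forall>n\<ge>n0.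
        prob_given_solvers P D M X
          {\<omega>' \<in> space P. SR_selection N f xstar X r isel n \<omega>'
                          < SR_solvers N f xstar M X (r n) \<omega>' + 2 * \<epsilon> (r n)} \<omega>
        \<ge> 1 - real M / (real (s n) * (\<epsilon> (lag (r n)))\<^sup>2)
      \<and> real (card (nopa_evaluations M r s n))
          = real (r n) * real M * (1 + (\<Sum>i=1..n. real (s i) / real (r n)))"
      using first unfolding good_selection_def by eventually_elim (rule with_card)
    assume sum: "summable (\<lambda>j. 1 / (real (s (Suc j)) * (\<epsilon> (lag (r (Suc j))))\<^sup>2))"
    have "AE \<omega> in P. \<exists>n0\<ge>1. \<forall>n\<ge>n0. SR_selection N f xstar X r isel n \<omega>
          < SR_solvers N f xstar M X (r n) \<omega> + 2 * \<epsilon> (r n)"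
      using second[OF sum] unfolding good_selection_def by eventually_elim blast
    then show "AE \<omega> in P. \<exists>n0\<ge>1. \<forall>n\<ge>n0.
        SR_selection N f xstar X r isel n \<omega>
          < SR_solvers N f xstar M X (r n) \<omega> + 2 * \<epsilon> (r n)
      \<and> real (card (nopa_evaluations M r s n))
          = real (r n) * real M * (1 + (\<Sum>i=1..n. real (s i) / real (r n)))"
      by eventually_elim (rule with_card)
  qed
qed

end
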